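(* Let $K$ be a field of characteristic not equal to $2$, let $\gamma\in K$, and let $f(x)=(x-\gamma)^2+\gamma-1$. Then $f^3(x+\gamma)$ is symmetrically reducible over $K$ if and only if $$\gamma=4\left(\frac{(t^2-8t+8)(t^2+8)}{(t^2-8)^2}\right)^4+1\quad\text{for some } t\in K.\qquad(\ast)$$ Suppose moreover that $K$ is a field with a non-trivial discrete valuation $v$ such that $v(5)$ is odd, and that $-1$ is not a square in $K$. Then $f^3(x)$ is newly reducible over $K$ whenever $t=25r$ in $(\ast)$, for any $r\in K$ with $v(r)\geq 0$. In particular, $K\in\mathcal{N}_{2,3}^\infty$.
   Context: $f^i$ denotes the $i$-th iterate of $f$ under composition, and $f^3(x+\gamma)$ is $f^3$ evaluated at $x+\gamma$. A polynomial $F\in K[x]$ of degree $2N$, $N\ge1$, is symmetrically reducible over $K$ if there exist a monic $g\in K[x]$ and $C\in K$ with $F(x)=C\,g(x)g(-x)$. "$f^3$ is newly reducible over $K$" means $f^2$ is irreducible over $K$ but $f^3$ is not irreducible over $K$. $K\in\mathcal{N}_{2,3}^\infty$ means that there are infinitely many $f\in K[x]$ of degree $2$ such that $f^3$ is newly reducible over $K$. Discrete valuations are maps $v:K^*\to\mathbb{Z}$, extended by $v(0)=\infty$.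
   Formalization: The equivalence is proved as "symmetrically reducible iff γ = 1 or (∗)", since the printed one fails at γ = 1 (e.g. K = ℚ: f³(x+1) = g(x)g(−x) with g = x⁴ − 2x², but (∗) needs 2 or −2 to be a square); t² ≠ 8 is made explicit in (∗). *)

theory Defs
  imports
    "HOL-Computational_Algebra.Computational_Algebra"
    "HOL-Library.Extended"
begin

definition poly_iterate :: "nat \<Rightarrow> 'a::comm_semiring_1 poly \<Rightarrow> 'a poly" where
  "poly_iterate i f = ((\<lambda>p. pcompose f p) ^^ i) [:0, 1:]"

definition symmetrically_reducible :: "'a::field poly \<Rightarrow> bool" where
  "symmetrically_reducible F \<longleftrightarrow>
     (\<exists>N::nat. 1 \<le> N \<and> degree F = 2 * N) \<and>
     (\<exists>g C. lead_coeff g = 1 \<and> F = smult C (g * pcompose g [:0, -1:]))"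

definition third_iterate_newly_reducible :: "'a::field poly \<Rightarrow> bool" where
  "third_iterate_newly_reducible f \<longleftrightarrow>
     irreducible (poly_iterate 2 f) \<and> \<not> irreducible (poly_iterate 3 f)"

text \<open>The class $\mathcal{N}_{2,3}^\infty$ of fields; the field is passed as a type.\<close>

definition in_N23_infinity :: "'a::field itself \<Rightarrow> bool" where
  "in_N23_infinity _ \<longleftrightarrow>
     infinite {f :: 'a poly. degree f = 2 \<and> third_iterate_newly_reducible f}"

text \<open>
  A discrete valuation is a map on nonzero elements, so the value of the function \<open>v\<close> at \<open>0\<close>
  is irrelevant; conditions that may involve \<open>0\<close> are stated through the extension
  with \<open>v(0) = \<infinity>\<close>. The value group is not required to be all of the integers.
\<close>

definition extended_valuation :: "('a::zero \<Rightarrow> int) \<Rightarrow> 'a \<Rightarrow> int extended" where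
  "extended_valuation v x = (if x = 0 then Pinf else Fin (v x))"

definition discrete_valuation :: "('a::field \<Rightarrow> int) \<Rightarrow> bool" where
  "discrete_valuation v \<longleftrightarrow>
     (\<forall>x y. x \<noteq> 0 \<longrightarrow> y \<noteq> 0 \<longrightarrow> v (x * y) = v x + v y) \<and>
     (\<forall>x y. min (extended_valuation v x) (extended_valuation v y)
              \<le> extended_valuation v (x + y))"

definition nontrivial_valuation :: "('a::field \<Rightarrow> int) \<Rightarrow> bool" where
  "nontrivial_valuation v \<longleftrightarrow> (\<exists>x. x \<noteq> 0 \<and> v x \<noteq> 0)"

text \<open>In particular the value is finite, i.e. the argument is nonzero.\<close>

definition odd_value :: "('a::field \<Rightarrow> int) \<Rightarrow> 'a \<Rightarrow> bool" where
  "odd_value v x \<longleftrightarrow> (\<exists>n. extended_valuation v x = Fin n \<and> odd n)"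

definition quadratic_family :: "'a::field \<Rightarrow> 'a poly" where
  "quadratic_family \<gamma> = [:-\<gamma>, 1:] ^ 2 + [:\<gamma> - 1:]"

text \<open>
  The rational parametrization of \<open>\<gamma>\<close>. Its denominator has to be nonzero, which is required
  explicitly because division by \<open>0\<close> yields \<open>0\<close> in HOL. The value \<open>\<gamma> = 1\<close> is attained only over
  fields that contain a square root of \<open>2\<close> or of \<open>-2\<close>, whereas for \<open>\<gamma> = 1\<close> the polynomial
  $f^3(x+\gamma) = g(x)\,g(-x)$ with $g = x^4 - 2x^2$ is symmetrically reducible over every field.
\<close>

definition gamma_parametrized :: "'a::field \<Rightarrow> 'a \<Rightarrow> bool" where
  "gamma_parametrized \<gamma> t \<longleftrightarrow>
     t ^ 2 - 8 \<noteq> 0 \<and>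
     \<gamma> = 4 * ((t ^ 2 - 8 * t + 8) * (t ^ 2 + 8) / (t ^ 2 - 8) ^ 2) ^ 4 + 1"

end

theory Submission
  imports Defs
begin

text \<open>
  Shifted by \<open>\<gamma>\<close>, the iterates of \<open>f = quadratic_family \<gamma>\<close> are even:
  $f^2(x+\gamma) = x^4 - 2x^2 + \gamma$ and $f^3(x+\gamma) = x^8 - 4x^6 + 4x^4 + \gamma - 1$.

  For a quartic $g = x^4 + ax^3 + bx^2 + cx + d$, the equation $f^3(x+\gamma) = g(x)\,g(-x)$ amounts
  to $a^2 = 2b + 4$, $b^2 + 2d = 2ac + 4$, $2bd = c^2$ and $d^2 = \gamma - 1$. Eliminating \<open>d\<close> leaves
  a quadratic equation for \<open>c\<close> with discriminant $4b(b+2)^2$. Hence either $b = -2$, which forces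
  $\gamma = 1$, or $b = s^2$ is a square, and the remaining condition is the conic
  $a^2 = 2s^2 + 4$. On it $\gamma = 4w^4 + 1$ with $w = a(a+2s)/4$, and projecting from its rational
  point $(2,0)$ gives the parametrization by \<open>t\<close>
  (\<open>symmetric_equations_imp_parametrized\<close>, \<open>parametrized_imp_symmetric_equations\<close>).

  Symmetric reducibility makes $f^3$ reducible, so new reducibility only needs that
  $x^4 - 2x^2 + \gamma$ is irreducible, and for this it suffices that neither \<open>\<gamma>\<close> nor $1 - \gamma$ is a
  square (\<open>irreducible_biquadratic\<close>). Since $1 - \gamma = -4w^4$, the second condition holds when $-1$
  is not a square and $w \neq 0$. For the first, \<open>w\<close> is congruent to 1 modulo \<open>t\<close>, and more
  precisely $\gamma = 5 + tu$ for a \<open>v\<close>-unit \<open>u\<close> as soon as $v(t) > 0$ (\<open>parametrized_near_5\<close>). If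
  $t = 25r$ with \<open>r\<close> integral, then $v(\gamma) = v(5)$ is odd. Taking $r = 5^n$, the values
  $v(\gamma - 5) = (n+2)\,v(5)$ are distinct, so infinitely many \<open>\<gamma>\<close> occur.
\<close>

section \<open>Shifted iterates of the quadratic family\<close>

lemma pcompose_quadratic_family:
  fixes \<gamma> :: "'a::field"
  shows "pcompose (quadratic_family \<gamma>) p = (p - [:\<gamma>:]) ^ 2 + [:\<gamma> - 1:]"
proof -
  have "pcompose [:- \<gamma>, 1:] p = p - [:\<gamma>:]"
    by (simp add: pcompose_pCons)
  then show ?thesis
    by (simp only: quadratic_family_def pcompose_add power2_eq_square pcompose_mult pcompose_const)
qed

lemma quadratic_family_shift:
  fixes \<gamma> :: "'a::field"
  shows "pcompose (quadratic_family \<gamma>) [:\<gamma>, 1:] = [:\<gamma> - 1, 0, 1:]"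
  by (simp add: pcompose_quadratic_family power2_eq_square)

lemma second_iterate_shift:
  fixes \<gamma> :: "'a::field"
  shows "pcompose (poly_iterate 2 (quadratic_family \<gamma>)) [:\<gamma>, 1:] = [:\<gamma>, 0, -2, 0, 1:]"
  by (simp add: poly_iterate_def numeral_2_eq_2 pcompose_idR flip: pcompose_assoc)
     (simp add: quadratic_family_shift, simp add: pcompose_quadratic_family power2_eq_square)

lemma third_iterate_shift:
  fixes \<gamma> :: "'a::field"
  shows "pcompose (poly_iterate 3 (quadratic_family \<gamma>)) [:\<gamma>, 1:] =
    [:\<gamma> - 1, 0, 0, 0, 4, 0, -4, 0, 1:]"
proof -
  have "pcompose (poly_iterate 3 (quadratic_family \<gamma>)) [:\<gamma>, 1:] =
      pcompose (quadratic_family \<gamma>) (pcompose (poly_iterate 2 (quadratic_family \<gamma>)) [:\<gamma>, 1:])"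
    by (simp add: poly_iterate_def numeral_3_eq_3 numeral_2_eq_2 pcompose_assoc)
  also have "\<dots> = [:\<gamma> - 1, 0, 0, 0, 4, 0, -4, 0, 1:]"
    by (simp add: second_iterate_shift pcompose_quadratic_family power2_eq_square)
  finally show ?thesis .
qed

lemma degree_quadratic_family: "degree (quadratic_family (\<gamma>::'a::field)) = 2"
  by (simp add: quadratic_family_def power2_eq_square)

lemma quadratic_family_eq_iff:
  fixes \<gamma> \<delta> :: "'a::field"
  assumes "(2::'a) \<noteq> 0"
  shows "quadratic_family \<gamma> = quadratic_family \<delta> \<longleftrightarrow> \<gamma> = \<delta>"
proof
  assume "quadratic_family \<gamma> = quadratic_family \<delta>"
  then have "2 * \<gamma> = 2 * \<delta>"
    by (simp add: quadratic_family_def power2_eq_square)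
  with assms show "\<gamma> = \<delta>" by simp
qed simp

section \<open>Symmetric factorizations of the third iterate\<close>

lemma two_nonzero_if_char_neq_2:
  assumes "CHAR('a::field) \<noteq> 2"
  shows "(2::'a) \<noteq> 0"
proof
  assume "(2::'a) = 0"
  then have "CHAR('a) dvd 2"
    using of_nat_eq_0_iff_char_dvd[where ?'a = 'a, of 2] by simp
  with assms CHAR_not_1[where ?'a = 'a] show False
    by (metis One_nat_def prime_nat_iff two_is_prime_nat)
qed

lemma poly_degree_4_expand:
  assumes "degree g = 4"
  shows "g = [:coeff g 0, coeff g 1, coeff g 2, coeff g 3, lead_coeff g:]"
proof (rule poly_eqI)
  fix n
  consider "n = 0" | "n = 1" | "n = 2" | "n = 3" | "n = 4" | k where "n = Suc (Suc (Suc (Suc (Suc k))))"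
    by (cases n; cases "n - 1"; cases "n - 2"; cases "n - 3"; cases "n - 4") auto
  then show "coeff g n = coeff [:coeff g 0, coeff g 1, coeff g 2, coeff g 3, lead_coeff g:] n"
    by cases (use assms in \<open>auto simp: numeral_eq_Suc coeff_eq_0\<close>)
qed

text \<open>Reflection preserves the degree, so \<open>g\<close> is a quartic; its leading term then forces the
  scalar to be 1.\<close>

lemma symmetrically_reducible_octic_iff:
  fixes e p q r :: "'a::field"
  shows "symmetrically_reducible [:e, 0, r, 0, q, 0, p, 0, 1:] \<longleftrightarrow>
    (\<exists>a b c d. 2 * b - a ^ 2 = p \<and> b ^ 2 + 2 * d - 2 * a * c = q \<and> 2 * b * d - c ^ 2 = r \<and> d ^ 2 = e)"
    (is "symmetrically_reducible ?F \<longleftrightarrow> ?R")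
proof -
  have expand: "?F = smult C ([:d, c, b, a, 1:] * pcompose [:d, c, b, a, 1:] [:0, -1:]) \<longleftrightarrow>
      C = 1 \<and> 2 * b - a ^ 2 = p \<and> b ^ 2 + 2 * d - 2 * a * c = q \<and> 2 * b * d - c ^ 2 = r \<and> d ^ 2 = e"
    for a b c d C :: 'a
    by (auto simp: pcompose_pCons power2_eq_square algebra_simps)
  show ?thesis
  proof
    assume "symmetrically_reducible ?F"
    then obtain g C where monic: "lead_coeff g = 1"
      and F: "?F = smult C (g * pcompose g [:0, -1:])"
      unfolding symmetrically_reducible_def by blast
    have "?F \<noteq> 0" by simp
    then have "C \<noteq> 0" "g \<noteq> 0" "pcompose g [:0, -1:] \<noteq> 0"
      using F by auto
    then have "8 = degree g + degree g"
      using arg_cong[OF F, of degree] by (simp add: degree_mult_eq degree_pcompose)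
    then have "degree g = 4" by simp
    with monic obtain a b c d where "g = [:d, c, b, a, 1:]"
      using poly_degree_4_expand by metis
    with F expand show ?R by blast
  next
    assume ?R
    then obtain a b c d where "?F = smult 1 ([:d, c, b, a, 1:] * pcompose [:d, c, b, a, 1:] [:0, -1:])"
      using expand by metis
    moreover have "lead_coeff [:d, c, b, a, 1:] = 1" by simp
    moreover have "degree ?F = 2 * 4" by simp
    moreover have "(1::nat) \<le> 4" by simp
    ultimately show "symmetrically_reducible ?F"
      unfolding symmetrically_reducible_def by blast
  qed
qed

lemma powers_of_two_nonzero:
  assumes "(2::'a::field) \<noteq> 0"
  shows "(4::'a) \<noteq> 0" "(8::'a) \<noteq> 0" "(32::'a) \<noteq> 0" "(64::'a) \<noteq> 0" "(256::'a) \<noteq> 0"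
  using power_not_zero[OF assms, of 2] power_not_zero[OF assms, of 3] power_not_zero[OF assms, of 5]
    power_not_zero[OF assms, of 6] power_not_zero[OF assms, of 8]
  by simp_all

text \<open>The parameter \<open>t\<close> is, up to the factor $-4$, the slope of the line through $(2, 0)$ and
  $(a, s)$. The tangent direction at $(2, 0)$ has no slope, but the point itself yields the same
  \<open>w\<close> as its antipode $(-2, 0)$, which is $t = 0$.\<close>

lemma conic_point_parametrized:
  fixes a s :: "'a::field"
  assumes two: "(2::'a) \<noteq> 0" and conic: "a ^ 2 = 2 * s ^ 2 + 4"
  shows "\<exists>t. gamma_parametrized (4 * (a * (a + 2 * s) / 4) ^ 4 + 1) t"
proof (cases "a = 2")
  case True
  with conic have "2 * s ^ 2 = 0" by simp
  with two have "s = 0" by simp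
  with True powers_of_two_nonzero[OF two] have "a * (a + 2 * s) / 4 = 1" by simp
  with powers_of_two_nonzero[OF two]
  have "gamma_parametrized (4 * (a * (a + 2 * s) / 4) ^ 4 + 1) 0"
    unfolding gamma_parametrized_def by simp
  then show ?thesis ..
next
  case False
  define z where "z = a - 2"
  have z: "z \<noteq> 0" and a: "a = z + 2" using False by (simp_all add: z_def)
  define t where "t = - 4 * s / z"
  have tz: "t * z = - 4 * s" using z by (simp add: t_def)
  have den: "(t ^ 2 - 8) * z = 32"
  proof -
    have "(t * z) ^ 2 = 8 * (2 * s ^ 2)" using tz by algebra
    also have "2 * s ^ 2 = z ^ 2 + 4 * z" using conic a by algebra
    finally have "((t ^ 2 - 8) * z) * z = 32 * z" by algebra
    with z show ?thesis by simp
  qed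
  have num1: "(t ^ 2 + 8) * z = 16 * a"
  proof -
    have "(t ^ 2 + 8) * z = (t ^ 2 - 8) * z + 16 * z" by algebra
    then show ?thesis using den a by simp
  qed
  have num2: "(t ^ 2 - 8 * t + 8) * z = 16 * (a + 2 * s)"
    using num1 tz by algebra
  have nz: "t ^ 2 - 8 \<noteq> 0" using den powers_of_two_nonzero[OF two] by auto
  have "(t ^ 2 - 8 * t + 8) * (t ^ 2 + 8) / (t ^ 2 - 8) ^ 2 =
      ((t ^ 2 - 8 * t + 8) * z) * ((t ^ 2 + 8) * z) / ((t ^ 2 - 8) * z) ^ 2"
    using z by (simp add: power2_eq_square)
  also have "\<dots> = (256 * (a * (a + 2 * s))) / (256 * 4)"
    unfolding num1 num2 den by (simp add: mult_ac)
  also have "\<dots> = a * (a + 2 * s) / 4"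
    using powers_of_two_nonzero(5)[OF two] by (rule mult_divide_mult_cancel_left)
  finally have "gamma_parametrized (4 * (a * (a + 2 * s) / 4) ^ 4 + 1) t"
    using nz unfolding gamma_parametrized_def by (simp only: simp_thms)
  then show ?thesis ..
qed

text \<open>With $c = ab + s(b+2)$ and $b = s^2$ the middle equation becomes
  $2d = (as + s^2 + 2)^2$, and on the conic $as + s^2 + 2 = a(a + 2s)/2 = 2w$. So $d = 2w^2$.\<close>

lemma symmetric_equations_imp_parametrized:
  fixes a b c d \<gamma> :: "'a::field"
  assumes two: "(2::'a) \<noteq> 0"
    and e6: "2 * b - a ^ 2 = -4" and e4: "b ^ 2 + 2 * d - 2 * a * c = 4"
    and e2: "2 * b * d - c ^ 2 = 0" and e0: "d ^ 2 = \<gamma> - 1"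
  shows "\<gamma> = 1 \<or> (\<exists>t. gamma_parametrized \<gamma> t)"
proof (cases "b + 2 = 0")
  case True
  then have "b = -2" by algebra
  with e6 have "a = 0" by simp
  with e4 \<open>b = -2\<close> have "2 * d = 0" by simp
  with two e0 show ?thesis by simp
next
  case False
  \<comment> \<open>This is the square root of \<open>b\<close> given by the discriminant.\<close>
  define s where "s = (c - a * b) / (b + 2)"
  have s: "s * (b + 2) = c - a * b" using False by (simp add: s_def)
  have c: "c = s * (b + 2) + a * b" using s by simp
  have a2: "a ^ 2 = 2 * b + 4" using e6 by (simp add: diff_eq_eq)
  have d2: "2 * d = 4 + 2 * a * c - b ^ 2" using e4 by (simp add: algebra_simps)
  have b: "s ^ 2 = b"
  proof -
    have "c ^ 2 = b * (2 * d)" using e2 by (simp add: mult_ac)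
    then have "(s * (b + 2) + a * b) ^ 2 = b * (4 + 2 * a * (s * (b + 2) + a * b) - b ^ 2)"
      unfolding d2 c .
    then have "s ^ 2 * (b + 2) ^ 2 = b * (4 + a ^ 2 * b - b ^ 2)" by algebra
    also have "\<dots> = b * (b + 2) ^ 2" unfolding a2 by algebra
    finally show ?thesis using False by simp
  qed
  have conic: "a ^ 2 = 2 * s ^ 2 + 4" using a2 b by simp
  define w where "w = a * (a + 2 * s) / 4"
  have "a * (a + 2 * s) = 4 * w" using powers_of_two_nonzero[OF two] by (simp add: w_def)
  then have "2 * (a * s + s ^ 2 + 2) = 2 * (2 * w)" using conic by algebra
  with two have w: "a * s + s ^ 2 + 2 = 2 * w" by (metis mult_left_cancel)
  have "2 * d = (a * s + s ^ 2 + 2) ^ 2"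
    unfolding d2 c b[symmetric] using conic by algebra
  also have "\<dots> = 2 * (2 * w ^ 2)" unfolding w by algebra
  finally have "d = 2 * w ^ 2" using two by (metis mult_left_cancel)
  with e0 have "\<gamma> = 4 * w ^ 4 + 1" by algebra
  then show ?thesis using conic_point_parametrized[OF two conic] by (simp add: w_def)
qed

text \<open>Here $(a, s)$ is the point of the conic with parameter \<open>t\<close>, and $2w = as + s^2 + 2$ there. The
  factor is $g = x^4 + ax^3 + s^2x^2 + 2swx + 2w^2$.\<close>

lemma parametrized_imp_symmetric_equations:
  fixes \<gamma> t :: "'a::field"
  assumes two: "(2::'a) \<noteq> 0" and par: "gamma_parametrized \<gamma> t"
  shows "\<exists>a b c d. 2 * b - a ^ 2 = -4 \<and> b ^ 2 + 2 * d - 2 * a * c = 4 \<and>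
    2 * b * d - c ^ 2 = 0 \<and> d ^ 2 = \<gamma> - 1"
proof -
  define D where "D = t ^ 2 - 8"
  have D: "D \<noteq> 0" using par by (simp add: gamma_parametrized_def D_def)
  define a where "a = 2 * (t ^ 2 + 8) / D"
  define s where "s = - 8 * t / D"
  define w where "w = (t ^ 2 - 8 * t + 8) * (t ^ 2 + 8) / D ^ 2"
  have g: "\<gamma> = 4 * w ^ 4 + 1" using par by (simp add: gamma_parametrized_def D_def w_def)
  have a: "a * D = 2 * (t ^ 2 + 8)" and s: "s * D = - 8 * t"
    and wD: "w * D ^ 2 = (t ^ 2 - 8 * t + 8) * (t ^ 2 + 8)"
    using D by (simp_all add: a_def s_def w_def)
  have conic: "a ^ 2 = 2 * s ^ 2 + 4"
  proof -
    have "(a * D) ^ 2 = 2 * (s * D) ^ 2 + 4 * D ^ 2"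
      unfolding a s unfolding D_def by algebra
    then have "a ^ 2 * D ^ 2 = (2 * s ^ 2 + 4) * D ^ 2"
      by (simp add: power_mult_distrib algebra_simps)
    with D show ?thesis by simp
  qed
  have E: "a * s + s ^ 2 + 2 = 2 * w"
  proof -
    have "(a * D) * (s * D) + (s * D) ^ 2 + 2 * D ^ 2 = 2 * (w * D ^ 2)"
      unfolding a s wD unfolding D_def by algebra
    then have "(a * s + s ^ 2 + 2) * D ^ 2 = (2 * w) * D ^ 2"
      by (simp add: power2_eq_square algebra_simps)
    with D show ?thesis by simp
  qed
  have "2 * s ^ 2 - a ^ 2 = -4" using conic by simp
  moreover have "(s ^ 2) ^ 2 + 2 * (2 * w ^ 2) - 2 * a * (s * (2 * w)) = 4"
  proof -
    have "(s ^ 2) ^ 2 + (a * s + s ^ 2 + 2) ^ 2 - 2 * a * (s * (a * s + s ^ 2 + 2)) = 4"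
      using conic by algebra
    then have "(s ^ 2) ^ 2 + (2 * w) ^ 2 - 2 * a * (s * (2 * w)) = 4" unfolding E .
    then show ?thesis by (simp add: power_mult_distrib)
  qed
  moreover have "2 * s ^ 2 * (2 * w ^ 2) - (s * (2 * w)) ^ 2 = 0" by algebra
  moreover have "(2 * w ^ 2) ^ 2 = \<gamma> - 1" using g by algebra
  ultimately show ?thesis by blast
qed

lemma symmetrically_reducible_third_iterate_iff:
  fixes \<gamma> :: "'a::field"
  assumes "(2::'a) \<noteq> 0"
  shows "symmetrically_reducible (pcompose (poly_iterate 3 (quadratic_family \<gamma>)) [:\<gamma>, 1:])
    \<longleftrightarrow> \<gamma> = 1 \<or> (\<exists>t. gamma_parametrized \<gamma> t)"
proof
  assume "symmetrically_reducible (pcompose (poly_iterate 3 (quadratic_family \<gamma>)) [:\<gamma>, 1:])"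
  then have "\<exists>a b c d. 2 * b - a ^ 2 = -4 \<and> b ^ 2 + 2 * d - 2 * a * c = 4 \<and>
      2 * b * d - c ^ 2 = 0 \<and> d ^ 2 = \<gamma> - 1"
    unfolding third_iterate_shift symmetrically_reducible_octic_iff .
  then obtain a b c d where "2 * b - a ^ 2 = -4" "b ^ 2 + 2 * d - 2 * a * c = 4"
      "2 * b * d - c ^ 2 = 0" "d ^ 2 = \<gamma> - 1"
    by blast
  then show "\<gamma> = 1 \<or> (\<exists>t. gamma_parametrized \<gamma> t)"
    by (rule symmetric_equations_imp_parametrized[OF assms])
next
  assume "\<gamma> = 1 \<or> (\<exists>t. gamma_parametrized \<gamma> t)"
  then show "symmetrically_reducible (pcompose (poly_iterate 3 (quadratic_family \<gamma>)) [:\<gamma>, 1:])"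
    unfolding third_iterate_shift symmetrically_reducible_octic_iff
  proof
    assume "\<gamma> = 1"
    \<comment> \<open>Here $g = x^4 - 2x^2$.\<close>
    then show "\<exists>a b c d. 2 * b - a ^ 2 = -4 \<and> b ^ 2 + 2 * d - 2 * a * c = 4 \<and>
        2 * b * d - c ^ 2 = 0 \<and> d ^ 2 = \<gamma> - 1"
      by (intro exI[of _ 0] exI[of _ "-2"]) simp
  qed (elim exE, rule parametrized_imp_symmetric_equations[OF assms])
qed

section \<open>Reducibility and irreducibility\<close>

lemma symmetrically_reducible_imp_not_irreducible:
  fixes F :: "'a::field poly"
  assumes "symmetrically_reducible F"
  shows "\<not> irreducible F"
proof
  assume irr: "irreducible F"
  obtain N g C where N: "1 \<le> N" "degree F = 2 * N" and F: "F = smult C g * pcompose g [:0, -1:]"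
    using assms unfolding symmetrically_reducible_def by auto
  have "F \<noteq> 0" using irr by auto
  then have nz: "smult C g \<noteq> 0" "pcompose g [:0, -1:] \<noteq> 0" "C \<noteq> 0" using F by auto
  then have "degree F = degree g + degree g"
    by (simp add: F degree_mult_eq degree_pcompose)
  then have "degree (smult C g) \<noteq> 0" "degree (pcompose g [:0, -1:]) \<noteq> 0"
    using N nz(3) by (simp_all add: degree_pcompose)
  then have "\<not> smult C g dvd 1" "\<not> pcompose g [:0, -1:] dvd 1"
    unfolding is_unit_iff_degree[OF nz(1)] is_unit_iff_degree[OF nz(2)] .
  with irr F show False by (metis irreducibleD)
qed

lemma irreducible_pcompose_shift_imp:
  fixes p :: "'a::field poly"
  assumes "irreducible (pcompose p [:c, 1:])"
  shows "irreducible p"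
proof (rule irreducibleI)
  have unit_iff: "pcompose q [:c, 1:] dvd 1 \<longleftrightarrow> q dvd 1" for q :: "'a poly"
  proof -
    have "pcompose q [:c, 1:] = 0 \<longleftrightarrow> q = 0"
      by (simp add: pcompose_eq_0_iff)
    then show ?thesis
      by (cases "q = 0") (simp_all add: is_unit_iff_degree degree_pcompose)
  qed
  show "p \<noteq> 0" using assms by auto
  show "\<not> p dvd 1" using assms unit_iff by (metis irreducible_not_unit)
  show "a dvd 1 \<or> b dvd 1" if "p = a * b" for a b
    using assms that unit_iff by (metis irreducibleD pcompose_mult)
qed

lemma irreducible_pcompose_shift_iff:
  fixes p :: "'a::field poly"
  shows "irreducible (pcompose p [:c, 1:]) \<longleftrightarrow> irreducible p"
proof
  assume "irreducible p"
  moreover have "pcompose (pcompose p [:c, 1:]) [:-c, 1:] = p"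
    by (simp add: pcompose_idR flip: pcompose_assoc) (simp add: pcompose_pCons pcompose_idR)
  ultimately show "irreducible (pcompose p [:c, 1:])"
    by (metis irreducible_pcompose_shift_imp)
qed (rule irreducible_pcompose_shift_imp)

text \<open>A root \<open>x\<close> makes $a^2 - b = (x^2 - a)^2$ a square. In a product
  $(x^2 + ux + q)(x^2 - ux + q')$ the vanishing linear coefficient gives $u = 0$ or $q = q'$: the
  former makes $a^2 - b = (q + a)^2$ a square, the latter $b = q^2$.\<close>

lemma irreducible_biquadratic:
  fixes a b :: "'a::field"
  assumes b: "\<not> (\<exists>y. y ^ 2 = b)" and disc: "\<not> (\<exists>y. y ^ 2 = a ^ 2 - b)"
  shows "irreducible [:b, 0, - 2 * a, 0, 1:]" (is "irreducible ?p")
proof (rule irreducibleI)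
  show "?p \<noteq> 0" by simp
  show "\<not> ?p dvd 1" by (simp add: is_unit_iff_degree)
  have no_root: "poly ?p x \<noteq> 0" for x
  proof
    assume "poly ?p x = 0"
    then have "(x ^ 2 - a) ^ 2 = a ^ 2 - b" by (simp, algebra)
    with disc show False by blast
  qed
  have no_linear: "degree f \<noteq> 1" if "f dvd ?p" for f
  proof
    assume "degree f = 1"
    then obtain r s where "f = [:r, s:]" "s \<noteq> 0" by (rule degree1_coeffs)
    then have "poly f (- r / s) = 0" by simp
    with that have "poly ?p (- r / s) = 0" by (metis dvdE mult_zero_left poly_mult)
    with no_root show False by blast
  qed
  fix f g assume fg: "?p = f * g"
  show "f dvd 1 \<or> g dvd 1"
  proof (rule ccontr)
    assume "\<not> (f dvd 1 \<or> g dvd 1)"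
    moreover have nz: "f \<noteq> 0" "g \<noteq> 0" using fg by auto
    ultimately have "degree f \<noteq> 0" "degree g \<noteq> 0" by (simp_all add: is_unit_iff_degree)
    moreover have "f dvd ?p" "g dvd ?p" unfolding fg by simp_all
    note this[THEN no_linear]
    moreover have "degree f + degree g = 4"
      using arg_cong[OF fg, of degree] nz by (simp add: degree_mult_eq)
    ultimately have "degree f = 2" "degree g = 2" by linarith+
    then obtain f0 f1 f2 g0 g1 g2 where f: "f = [:f0, f1, f2:]" and g: "g = [:g0, g1, g2:]"
      using degree2_coeffs by metis
    have c: "f2 * g2 = 1" "f2 * g1 + f1 * g2 = 0" "f2 * g0 + f1 * g1 + f0 * g2 = - 2 * a"
      "f1 * g0 + f0 * g1 = 0" "f0 * g0 = b"
      using fg unfolding f g by (simp_all add: algebra_simps)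
    \<comment> \<open>Normalized to be monic, the factors are $x^2 + ux + q$ and $x^2 - ux + q'$.\<close>
    define u q q' where "u = f1 * g2" and "q = f0 * g2" and "q' = g0 * f2"
    have eqs: "q + q' - u ^ 2 = - 2 * a" "u * (q' - q) = 0" "q * q' = b"
      unfolding u_def q_def q'_def using c by algebra+
    from eqs(2) consider "u = 0" | "q' = q" by auto
    then show False
    proof cases
      case 1
      with eqs have "(q + a) ^ 2 = a ^ 2 - b" by algebra
      with disc show False by blast
    next
      case 2
      with eqs have "q ^ 2 = b" by algebra
      with b show False by blast
    qed
  qed
qed

lemma irreducible_second_iterate:
  fixes \<gamma> :: "'a::field"
  assumes "\<not> (\<exists>y. y ^ 2 = \<gamma>)" and "\<not> (\<exists>y. y ^ 2 = 1 - \<gamma>)"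
  shows "irreducible (poly_iterate 2 (quadratic_family \<gamma>))"
proof (rule irreducible_pcompose_shift_imp)
  show "irreducible (pcompose (poly_iterate 2 (quadratic_family \<gamma>)) [:\<gamma>, 1:])"
    using irreducible_biquadratic[of \<gamma> 1] assms by (simp add: second_iterate_shift)
qed

section \<open>Valuations with residue characteristic 5\<close>

text \<open>These sets are fractional ideals of the valuation ring. They avoid arithmetic with an
  infinite value: the case 0 is split off because \<open>v 0\<close> is an arbitrary integer.\<close>

definition value_at_least :: "('a::zero \<Rightarrow> int) \<Rightarrow> int \<Rightarrow> 'a \<Rightarrow> bool" where
  "value_at_least v n x \<longleftrightarrow> x = 0 \<or> n \<le> v x"

definition valuation_unit :: "('a::zero \<Rightarrow> int) \<Rightarrow> 'a \<Rightarrow> bool" where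
  "valuation_unit v x \<longleftrightarrow> x \<noteq> 0 \<and> v x = 0"

context
  fixes v :: "'a::field \<Rightarrow> int"
  assumes v: "discrete_valuation v"
begin

lemma valuation_mult: "x \<noteq> 0 \<Longrightarrow> y \<noteq> 0 \<Longrightarrow> v (x * y) = v x + v y"
  using v by (simp add: discrete_valuation_def)

lemma valuation_one: "v 1 = 0"
  using valuation_mult[of 1 1] by simp

lemma valuation_minus: "v (- x) = v x"
proof (cases "x = 0")
  case False
  have "v (-1) + v (-1) = 0" using valuation_mult[of "-1" "-1"] valuation_one by simp
  with False show ?thesis using valuation_mult[of "-1" x] by simp
qed simp

lemma valuation_power: "x \<noteq> 0 \<Longrightarrow> v (x ^ n) = int n * v x"
  by (induction n) (simp_all add: valuation_one valuation_mult algebra_simps)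

lemma value_at_least_add:
  "value_at_least v n x \<Longrightarrow> value_at_least v n y \<Longrightarrow> value_at_least v n (x + y)"
proof -
  assume *: "value_at_least v n x" "value_at_least v n y"
  have "min (extended_valuation v x) (extended_valuation v y) \<le> extended_valuation v (x + y)"
    using v by (simp add: discrete_valuation_def)
  with * show ?thesis
    by (auto simp: value_at_least_def extended_valuation_def min_def split: if_splits)
qed

lemma value_at_least_minus: "value_at_least v n (- x) \<longleftrightarrow> value_at_least v n x"
  by (simp add: value_at_least_def valuation_minus)

lemma value_at_least_mult:
  "value_at_least v m x \<Longrightarrow> value_at_least v n y \<Longrightarrow> value_at_least v (m + n) (x * y)"
  by (cases "x = 0"; cases "y = 0") (simp_all add: value_at_least_def valuation_mult)

lemma integral_of_nat: "value_at_least v 0 (of_nat n)"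
proof (induction n)
  case (Suc n)
  then show ?case
    using value_at_least_add[of 0 1 "of_nat n"] by (simp add: value_at_least_def valuation_one)
qed (simp add: value_at_least_def)

lemma integral_numeral: "value_at_least v 0 (numeral k)"
  using integral_of_nat[of "numeral k"] by simp

lemma valuation_unit_imp_integral: "valuation_unit v x \<Longrightarrow> value_at_least v 0 x"
  by (simp add: valuation_unit_def value_at_least_def)

lemma valuation_unit_mult: "valuation_unit v x \<Longrightarrow> valuation_unit v y \<Longrightarrow> valuation_unit v (x * y)"
  by (simp add: valuation_unit_def valuation_mult)

lemma valuation_unit_minus: "valuation_unit v (- x) \<longleftrightarrow> valuation_unit v x"
  by (simp add: valuation_unit_def valuation_minus)

lemma valuation_unit_power: "valuation_unit v x \<Longrightarrow> valuation_unit v (x ^ n)"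
  by (simp add: valuation_unit_def valuation_power)

lemma valuation_unit_divide:
  assumes "valuation_unit v x" "valuation_unit v y"
  shows "valuation_unit v (x / y)"
  using assms valuation_mult[of "x / y" y] by (simp add: valuation_unit_def)

lemma valuation_add_dominant:
  assumes "x \<noteq> 0" "value_at_least v (v x + 1) y"
  shows "x + y \<noteq> 0 \<and> v (x + y) = v x"
proof (cases "y = 0")
  case True
  with assms show ?thesis by simp
next
  case False
  then have y: "v x < v y" using assms by (simp add: value_at_least_def)
  then have nz: "x + y \<noteq> 0" using valuation_minus[of x] by (auto simp: add_eq_0_iff)
  have "value_at_least v (v x) (x + y)"
    using y by (intro value_at_least_add) (simp_all add: value_at_least_def)
  moreover have "v (x + y) \<le> v x"
  proof (rule ccontr)
    assume "\<not> v (x + y) \<le> v x"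
    with y have "value_at_least v (v x + 1) ((x + y) + (- y))"
      by (intro value_at_least_add[of _ "x + y" "- y"])
         (simp_all add: value_at_least_def valuation_minus)
    with assms(1) show False by (simp add: value_at_least_def)
  qed
  ultimately show ?thesis using nz by (simp add: value_at_least_def)
qed

lemma valuation_unit_add:
  "valuation_unit v x \<Longrightarrow> value_at_least v 1 y \<Longrightarrow> valuation_unit v (x + y)"
  using valuation_add_dominant[of x y] by (simp add: valuation_unit_def)

lemma odd_valuation_imp_not_square:
  assumes "x \<noteq> 0" "odd (v x)"
  shows "\<not> (\<exists>y. y ^ 2 = x)"
proof
  assume "\<exists>y. y ^ 2 = x"
  then obtain y where "y ^ 2 = x" ..
  with assms valuation_power[of y 2] show False by (cases "y = 0") auto
qed

context
  assumes five: "odd_value v 5"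
begin

lemma five_nonzero: "(5::'a) \<noteq> 0"
  using five by (auto simp: odd_value_def extended_valuation_def)

lemma odd_valuation_five: "odd (v 5)"
  using five five_nonzero by (auto simp: odd_value_def extended_valuation_def)

lemma valuation_five_pos: "1 \<le> v 5"
proof -
  have "0 \<le> v 5" using integral_numeral[of "num.Bit1 (num.Bit0 num.One)"] five_nonzero
    by (simp add: value_at_least_def)
  moreover have "v 5 \<noteq> 0" using odd_valuation_five by auto
  ultimately show ?thesis by linarith
qed

text \<open>In the residue field 4 equals $-1$.\<close>

lemma valuation_unit_four: "valuation_unit v 4"
proof -
  have "valuation_unit v (-1 + 5)"
    using valuation_five_pos
    by (intro valuation_unit_add)
       (simp_all add: valuation_unit_minus, simp_all add: valuation_unit_def valuation_one value_at_least_def)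
  then show ?thesis by simp
qed

lemma valuation_unit_two: "valuation_unit v 2"
proof -
  have nz: "(2::'a) \<noteq> 0"
  proof
    assume "(2::'a) = 0"
    then have "2 * 2 = (0::'a)" by (simp only: mult_zero_left)
    then have "(4::'a) = 0" by simp
    with valuation_unit_four show False by (simp add: valuation_unit_def)
  qed
  with valuation_mult[of 2 2] valuation_unit_four show ?thesis by (simp add: valuation_unit_def)
qed

lemma valuation_unit_eight: "valuation_unit v 8"
  using valuation_unit_mult[OF valuation_unit_two valuation_unit_four] by simp

lemma parametrization_denominator_unit:
  assumes t: "value_at_least v 1 t"
  shows "valuation_unit v (t ^ 2 - 8)"
proof -
  have "value_at_least v 1 (t ^ 2)"
    using value_at_least_mult[OF t t] by (auto simp: value_at_least_def power2_eq_square)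
  then show ?thesis
    using valuation_unit_add[of "-8" "t ^ 2"] valuation_unit_eight
    by (simp add: valuation_unit_minus)
qed

text \<open>The factorizations $w - 1 = -8t\,(t^2 - 4t + 8)/(t^2 - 8)^2$ and
  $w^4 - 1 = (w - 1)(4 + (w - 1)(w^2 + 2w + 3))$ show that $\gamma - 5 = 4(w^4 - 1)$ is \<open>t\<close> times a
  unit: modulo \<open>t\<close> the cofactor of \<open>t\<close> in the first is $-1$ and that of $w - 1$ in the second is 4,
  which is a unit because the residue characteristic is 5.\<close>

lemma parametrized_near_5:
  assumes t: "value_at_least v 1 t" and par: "gamma_parametrized \<gamma> t"
  obtains w u where "valuation_unit v w" "\<gamma> = 4 * w ^ 4 + 1" "valuation_unit v u" "\<gamma> = 5 + t * u"
proof -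
  define D where "D = t ^ 2 - 8"
  define w where "w = (t ^ 2 - 8 * t + 8) * (t ^ 2 + 8) / D ^ 2"
  have D: "valuation_unit v D"
    unfolding D_def by (rule parametrization_denominator_unit[OF t])
  then have D0: "D \<noteq> 0" by (simp add: valuation_unit_def)
  have \<gamma>: "\<gamma> = 4 * w ^ 4 + 1" using par by (simp add: gamma_parametrized_def w_def D_def)
  have t0: "value_at_least v 0 t" using t by (auto simp: value_at_least_def)
  have tx: "value_at_least v 1 (t * x)" if "value_at_least v 0 x" for x
    using value_at_least_mult[OF t that] by simp
  have "value_at_least v 0 (t + - 4)"
    using valuation_unit_imp_integral[OF valuation_unit_four]
    by (intro value_at_least_add t0) (simp add: value_at_least_minus)
  then have "valuation_unit v (8 + t * (t + - 4))"
    by (intro valuation_unit_add valuation_unit_eight tx)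
  then have U: "valuation_unit v (t ^ 2 - 4 * t + 8)"
    by (simp add: power2_eq_square algebra_simps)
  define m where "m = - 8 * (t ^ 2 - 4 * t + 8) / D ^ 2"
  have m: "valuation_unit v m"
    unfolding m_def
    by (intro valuation_unit_divide valuation_unit_mult valuation_unit_power U D)
       (simp add: valuation_unit_minus valuation_unit_eight)
  have w: "w = 1 + t * m"
  proof -
    have wD: "w * D ^ 2 = (t ^ 2 - 8 * t + 8) * (t ^ 2 + 8)"
      and mD: "m * D ^ 2 = - 8 * (t ^ 2 - 4 * t + 8)"
      using D0 by (simp_all add: w_def m_def)
    have "w * D ^ 2 = D ^ 2 + t * (m * D ^ 2)"
      unfolding wD mD unfolding D_def by algebra
    also have "\<dots> = (1 + t * m) * D ^ 2" by (simp add: distrib_right)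
    finally have "w * D ^ 2 = (1 + t * m) * D ^ 2" .
    with D0 show ?thesis by simp
  qed
  have wu: "valuation_unit v w"
    unfolding w using m
    by (intro valuation_unit_add tx valuation_unit_imp_integral)
       (simp_all add: valuation_unit_def valuation_one)
  have "value_at_least v 0 (w * w + 2 * w + 3)"
    using value_at_least_mult[of 0 w 0 w] value_at_least_mult[of 0 2 0 w] wu
    by (intro value_at_least_add integral_numeral)
       (simp_all add: integral_numeral valuation_unit_imp_integral)
  then have "value_at_least v 0 (m * (w * w + 2 * w + 3))"
    using value_at_least_mult[of 0 m 0] m by (simp add: valuation_unit_imp_integral)
  then have k: "valuation_unit v (4 + t * (m * (w * w + 2 * w + 3)))"
    by (intro valuation_unit_add valuation_unit_four tx)
  define u where "u = 4 * (m * (4 + t * (m * (w * w + 2 * w + 3))))"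
  have "valuation_unit v u"
    unfolding u_def by (intro valuation_unit_mult valuation_unit_four m k)
  moreover have "\<gamma> = 5 + t * u"
  proof -
    have tm: "t * m = w - 1" using w by simp
    have "t * u = 4 * ((t * m) * (4 + (t * m) * (w * w + 2 * w + 3)))"
      by (simp add: u_def mult_ac)
    then show ?thesis unfolding \<gamma> tm by algebra
  qed
  ultimately show thesis using that wu \<gamma> by blast
qed

section \<open>Newly reducible third iterates\<close>

lemma third_iterate_newly_reducible_if_parametrized:
  assumes minus_one: "\<not> (\<exists>i::'a. i ^ 2 = -1)"
    and r: "value_at_least v 0 r" and par: "gamma_parametrized \<gamma> (25 * r)"
  shows "third_iterate_newly_reducible (quadratic_family \<gamma>)"
proof -
  have two: "(2::'a) \<noteq> 0" using valuation_unit_two by (simp add: valuation_unit_def)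
  have v25: "v 25 = 2 * v 5" "(25::'a) \<noteq> 0"
    using valuation_power[OF five_nonzero, of 2] power_not_zero[OF five_nonzero, of 2] by simp_all
  then have t: "value_at_least v (2 * v 5) (25 * r)"
    using value_at_least_mult[of "2 * v 5" 25 0 r] r by (simp add: value_at_least_def)
  then have t1: "value_at_least v 1 (25 * r)"
    using valuation_five_pos by (auto simp: value_at_least_def)
  obtain w u where w: "valuation_unit v w" "\<gamma> = 4 * w ^ 4 + 1"
    and u: "valuation_unit v u" "\<gamma> = 5 + 25 * r * u"
    using parametrized_near_5[OF t1 par] .
  have "value_at_least v (v 5 + 1) (25 * r * u)"
    using value_at_least_mult[OF t valuation_unit_imp_integral[OF u(1)]] valuation_five_pos
    by (auto simp: value_at_least_def)
  then have "\<gamma> \<noteq> 0 \<and> v \<gamma> = v 5"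
    unfolding u(2) by (rule valuation_add_dominant[OF five_nonzero])
  then have not_square: "\<not> (\<exists>y. y ^ 2 = \<gamma>)"
    using odd_valuation_imp_not_square odd_valuation_five by metis
  have "\<not> (\<exists>y. y ^ 2 = 1 - \<gamma>)"
  proof
    assume "\<exists>y. y ^ 2 = 1 - \<gamma>"
    then obtain y where "y ^ 2 = 1 - \<gamma>" ..
    define x where "x = 2 * w ^ 2"
    have "y ^ 2 = - (x ^ 2)" using \<open>y ^ 2 = 1 - \<gamma>\<close> w(2) x_def by algebra
    moreover have "x \<noteq> 0" using two w(1) by (simp add: valuation_unit_def x_def)
    ultimately have "(y / x) ^ 2 = -1" by (simp add: power_divide)
    with minus_one show False by blast
  qed
  with not_square have irr: "irreducible (poly_iterate 2 (quadratic_family \<gamma>))"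
    by (rule irreducible_second_iterate)
  have "symmetrically_reducible (pcompose (poly_iterate 3 (quadratic_family \<gamma>)) [:\<gamma>, 1:])"
    using symmetrically_reducible_third_iterate_iff[OF two] par by blast
  then have "\<not> irreducible (poly_iterate 3 (quadratic_family \<gamma>))"
    using symmetrically_reducible_imp_not_irreducible irreducible_pcompose_shift_iff by blast
  with irr show ?thesis by (simp add: third_iterate_newly_reducible_def)
qed

lemma infinitely_many_newly_reducible:
  assumes minus_one: "\<not> (\<exists>i::'a. i ^ 2 = -1)"
  shows "in_N23_infinity TYPE('a)"
proof -
  have two: "(2::'a) \<noteq> 0" using valuation_unit_two by (simp add: valuation_unit_def)
  have five_power: "(25::'a) * 5 ^ n = 5 ^ (n + 2)" for n by (simp add: power_add)
  have vt: "v (25 * 5 ^ n) = int (n + 2) * v 5" for n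
    unfolding five_power by (rule valuation_power[OF five_nonzero])
  have t0: "(25::'a) * 5 ^ n \<noteq> 0" for n
    unfolding five_power by (rule power_not_zero[OF five_nonzero])
  have r: "value_at_least v 0 (5 ^ n)" for n
    using valuation_power[OF five_nonzero, of n] valuation_five_pos by (simp add: value_at_least_def)
  have t: "value_at_least v 1 (25 * 5 ^ n)" for n
  proof -
    have "1 * 1 \<le> int (n + 2) * v 5"
      using valuation_five_pos by (intro mult_mono) auto
    then show ?thesis by (simp add: value_at_least_def vt)
  qed
  have "\<exists>\<gamma>::'a. gamma_parametrized \<gamma> (25 * 5 ^ n)" for n
    using parametrization_denominator_unit[OF t[of n]]
    by (simp add: gamma_parametrized_def valuation_unit_def)
  then obtain \<gamma> :: "nat \<Rightarrow> 'a" where \<gamma>: "gamma_parametrized (\<gamma> n) (25 * 5 ^ n)" for n by metis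
  have v\<gamma>: "v (\<gamma> n - 5) = int (n + 2) * v 5" for n
  proof -
    obtain u where "valuation_unit v u" "\<gamma> n = 5 + 25 * 5 ^ n * u"
      using parametrized_near_5[OF t \<gamma>] by metis
    then show ?thesis
      using valuation_mult[OF t0[of n], of u] vt by (simp add: valuation_unit_def)
  qed
  have "inj (\<lambda>n. quadratic_family (\<gamma> n))"
  proof (rule injI)
    fix m n assume "quadratic_family (\<gamma> m) = quadratic_family (\<gamma> n)"
    then have "v (\<gamma> m - 5) = v (\<gamma> n - 5)" by (simp add: quadratic_family_eq_iff[OF two])
    then show "m = n" using valuation_five_pos by (simp add: v\<gamma>)
  qed
  then have "infinite (range (\<lambda>n. quadratic_family (\<gamma> n)))"
    by (rule range_inj_infinite)
  moreover have "range (\<lambda>n. quadratic_family (\<gamma> n)) \<subseteq>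
      {f. degree f = 2 \<and> third_iterate_newly_reducible f}"
    using third_iterate_newly_reducible_if_parametrized[OF minus_one r \<gamma>] degree_quadratic_family
    by auto
  ultimately show ?thesis
    unfolding in_N23_infinity_def by (rule infinite_super[rotated])
qed

end

end

theorem proposition3p6:
  fixes \<gamma> :: "'a::field"
  assumes "CHAR('a) \<noteq> 2"
  shows "(symmetrically_reducible (pcompose (poly_iterate 3 (quadratic_family \<gamma>)) [:\<gamma>, 1:])
            \<longleftrightarrow> \<gamma> = 1 \<or> (\<exists>t. gamma_parametrized \<gamma> t)) \<and>
         (\<forall>v :: 'a \<Rightarrow> int.
            discrete_valuation v \<and> nontrivial_valuation v \<and> odd_value v 5 \<and>
            \<not> (\<exists>i::'a. i ^ 2 = -1) \<longrightarrow>
              (\<forall>r. extended_valuation v r \<ge> 0 \<and> gamma_parametrized \<gamma> (25 * r) \<longrightarrow>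
                 third_iterate_newly_reducible (quadratic_family \<gamma>)) \<and>
              in_N23_infinity TYPE('a))"
proof -
  have integral: "value_at_least v 0 r" if "extended_valuation v r \<ge> 0" for v and r :: 'a
    using that by (auto simp: extended_valuation_def value_at_least_def zero_extended_def split: if_splits)
  show ?thesis
    using symmetrically_reducible_third_iterate_iff[OF two_nonzero_if_char_neq_2[OF assms]]
      third_iterate_newly_reducible_if_parametrized infinitely_many_newly_reducible integral
    by blast
qed

end
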